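(* There exist absolute constants $C, C' > 0$ and $n_0 \in \mathbb{N}$ such that for every integer $n \geq n_0$ there exist a probability space $(\Omega,\mu)$ and a real-valued orthonormal system $\{\phi_0,\phi_1,\ldots,\phi_n\}$ of $n+1$ functions in $L^2(\Omega,\mu)$ satisfying $\|\phi_j\|_{L^\infty} \leq 7$ for all $0 \leq j \leq n$ and satisfying the $\psi_2(C)$ condition, and such that $$\Big\| \sum_{j=0}^{n} a_j \phi_j \Big\|_{L^{\infty}} \leq \frac{C'}{\sqrt{\log n}} \sum_{j=0}^{n}|a_j|$$ for some choice of scalars $a_0,\ldots,a_n$, not all zero.
   Context: For a measurable function $f$ on a probability space, $\|f\|_{\psi_2} = \inf\{t>0 : \int (e^{|f|^2/t^2}-1)\,d\mu \leq 1\}$ is the Orlicz norm associated with $\psi_2(x)=e^{|x|^2}-1$. A system $\{\phi_j\}$ satisfies the $\psi_2(C)$ condition if $\|\sum_j a_j\phi_j\|_{\psi_2} \leq C\left(\sum_j |a_j|^2\right)^{1/2}$ for all scalars $a_j$ (finitely many nonzero). *)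

theory Defs
  imports "HOL-Probability.Probability"
begin

text \<open>
  Both norms take values in \<^typ>\<open>ennreal\<close>, so that they are \<open>\<infinity>\<close> (and not an arbitrary real
  number) for functions outside the respective space; in particular \<open>Inf {} = \<infinity>\<close> below.
\<close>

definition psi2_norm :: "'a measure \<Rightarrow> ('a \<Rightarrow> 'b::real_normed_vector) \<Rightarrow> ennreal" where
  "psi2_norm M f =
    Inf {ennreal t | t::real. t > 0 \<and>
           (\<integral>\<^sup>+ x. ennreal (exp ((norm (f x))\<^sup>2 / t\<^sup>2) - 1) \<partial>M) \<le> 1}"

definition Linf_norm :: "'a measure \<Rightarrow> ('a \<Rightarrow> 'b::real_normed_vector) \<Rightarrow> ennreal" where
  "Linf_norm M f = esssup M (\<lambda>x. ennreal (norm (f x)))"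

text \<open>
  Scalars are complex here, also for a system of real-valued functions (embedded by
  \<^const>\<open>complex_of_real\<close>). The pairs of a finite set \<open>F\<close> and coefficients \<open>a\<close> on it encode
  the coefficient families with finitely many nonzero entries.
\<close>

definition psi2_condition ::
    "'a measure \<Rightarrow> 'i set \<Rightarrow> ('i \<Rightarrow> 'a \<Rightarrow> complex) \<Rightarrow> real \<Rightarrow> bool" where
  "psi2_condition M J \<phi> C \<longleftrightarrow>
    (\<forall>F a. finite F \<and> F \<subseteq> J \<longrightarrow>
       psi2_norm M (\<lambda>x. \<Sum>j\<in>F. a j * \<phi> j x) \<le> ennreal (C * sqrt (\<Sum>j\<in>F. (cmod (a j))\<^sup>2)))"

definition orthonormal_system ::
    "'a measure \<Rightarrow> 'i set \<Rightarrow> ('i \<Rightarrow> 'a \<Rightarrow> real) \<Rightarrow> bool" where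
  "orthonormal_system M J \<phi> \<longleftrightarrow>
    (\<forall>j\<in>J. \<phi> j \<in> borel_measurable M \<and> integrable M (\<lambda>x. (\<phi> j x)\<^sup>2)) \<and>
    (\<forall>i\<in>J. \<forall>j\<in>J. (\<integral>x. \<phi> i x * \<phi> j x \<partial>M) = (if i = j then 1 else 0))"

text \<open>
  HOL cannot quantify existentially over types, so a statement ``there are a probability space
  and functions \<open>\<phi>\<^sub>0, \<dots>, \<phi>\<^sub>n\<close> on it'' has to fix the type of the points. Taking real sequences
  loses nothing when the properties claimed depend only on the joint distribution of
  \<open>\<phi>\<^sub>0, \<dots>, \<phi>\<^sub>n\<close>: that distribution lives on the real sequences, with the coordinates as functions.
\<close>

type_synonym sample_point = "nat \<Rightarrow> real"

end

theory Submission
  imports Defs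
begin

text \<open>
  Take \<open>N = n + 1\<close> independent Rademacher signs \<open>x\<^sub>0, \<dots>, x\<^sub>n\<close> with sum \<open>S\<close>, under the uniform
  probability \<open>P\<close> on the sign cube. They are orthonormal, bounded and \<open>\<psi>\<^sub>2\<close>, and \<open>S\<close> has size
  about \<open>\<surd>N\<close> except on a set of small probability; only there does \<open>\<bar>S\<bar>\<close> get as large as \<open>N\<close>.
  The idea is to give this exceptional set more mass and to shrink the functions on it accordingly:
  with \<open>p = (1 + S\<^sup>2 / N) / 2\<close> put
  \<open>d\<mu> = p dP\<close> and \<open>\<phi>\<^sub>j = x\<^sub>j / \<surd>p\<close>.

  Since \<open>S\<^sup>2\<close> has mean \<open>N\<close>, \<open>\<mu>\<close> is a probability measure. The products \<open>\<phi>\<^sub>i \<phi>\<^sub>j d\<mu> = x\<^sub>i x\<^sub>j dP\<close>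
  are those of the signs, so orthonormality is inherited. As \<open>p \<ge> 1/2\<close>, each \<open>\<phi>\<^sub>j\<close> is at
  most \<open>\<surd>2\<close> in absolute value, and \<open>(\<Sum>\<^sub>j \<phi>\<^sub>j)\<^sup>2 = S\<^sup>2 / p \<le> 2N\<close> (\<open>abs_sum_tilted_sign_le\<close>).
  With all coefficients equal to \<open>1\<close> the ratio of the two sides is therefore of
  order \<open>1 / \<surd>n\<close>, much smaller than \<open>1 / \<surd>(log n)\<close>.

  The \<open>\<psi>\<^sub>2\<close> condition survives because the extra mass is paid for by the smaller values: by
  convexity \<open>c (exp (y / c) - 1) \<le> exp y - 1\<close> for \<open>c \<ge> 1\<close>, which with \<open>c = 2p\<close>
  bounds the exponential integral of \<open>\<Sum>\<^sub>j a\<^sub>j \<phi>\<^sub>j\<close> under \<open>\<mu>\<close> by that of \<open>\<Sum>\<^sub>j a\<^sub>j x\<^sub>j\<close>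
  under \<open>P\<close> (\<open>psi2_norm_tilted_sign_le\<close>). For the signs this is Khintchine's inequality in
  exponential form (\<open>sum_sign_cube_exp_square_le\<close>).
\<close>

section \<open>Rademacher sums\<close>

definition sign_cube :: "'i set \<Rightarrow> ('i \<Rightarrow> real) set" where
  "sign_cube I = I \<rightarrow>\<^sub>E {-1, 1}"

lemma finite_sign_cube: "finite I \<Longrightarrow> finite (sign_cube I)"
  unfolding sign_cube_def by (intro finite_PiE) auto

lemma card_sign_cube: "finite I \<Longrightarrow> card (sign_cube I) = 2 ^ card I"
  unfolding sign_cube_def by (simp add: card_funcsetE numeral_2_eq_2)

lemma sign_cube_abs: "x \<in> sign_cube I \<Longrightarrow> j \<in> I \<Longrightarrow> \<bar>x j\<bar> = 1"
  unfolding sign_cube_def by (auto dest: PiE_mem)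

text \<open>Independence of the coordinates: the mean of a product is the product of the means. As below,
  averages over the cube are multiplied through by its size \<open>2 ^ card I\<close>.\<close>

lemma sum_sign_cube_prod:
  fixes f :: "'i \<Rightarrow> real \<Rightarrow> real"
  assumes "finite I"
  shows "(\<Sum>x\<in>sign_cube I. \<Prod>j\<in>I. f j (x j)) = (\<Prod>j\<in>I. f j (-1) + f j 1)"
  unfolding sign_cube_def using assms by (subst prod_sum_PiE[symmetric]) auto

lemma sum_sign_cube_mult:
  assumes "finite I" "i \<in> I" "j \<in> I"
  shows "(\<Sum>x\<in>sign_cube I. x i * x j) = (if i = j then 2 ^ card I else 0)"
proof (cases "i = j")
  case True
  have "x i * x i = 1" if "x \<in> sign_cube I" for x
    using sign_cube_abs[OF that assms(2)] by (metis abs_mult_self_eq mult_1)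
  then show ?thesis
    using True assms by (simp add: card_sign_cube)
next
  case False
  \<comment> \<open>the product \<open>x i * x j\<close> written as a product over all coordinates, whose factor at \<open>i\<close> has
    mean zero\<close>
  define f where "f = (\<lambda>k (v::real). (if k = i then v else 1) * (if k = j then v else 1))"
  have "(\<Sum>x\<in>sign_cube I. x i * x j) = (\<Sum>x\<in>sign_cube I. \<Prod>k\<in>I. f k (x k))"
    using assms by (simp add: f_def prod.distrib)
  also have "\<dots> = (\<Prod>k\<in>I. f k (-1) + f k 1)"
    using assms(1) by (rule sum_sign_cube_prod)
  also have "\<dots> = 0"
    using assms False by (intro prod_zero) (auto simp: f_def intro!: bexI[of _ i])
  finally show ?thesis
    using False by simp
qed

lemma sum_sign_cube_sum_square:
  assumes "finite I"
  shows "(\<Sum>x\<in>sign_cube I. (\<Sum>j\<in>I. x j)\<^sup>2) = card I * 2 ^ card I"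
proof -
  have "(\<Sum>x\<in>sign_cube I. (\<Sum>j\<in>I. x j)\<^sup>2) = (\<Sum>x\<in>sign_cube I. \<Sum>i\<in>I. \<Sum>j\<in>I. x i * x j)"
    by (simp add: power2_eq_square sum_product)
  also have "\<dots> = (\<Sum>i\<in>I. \<Sum>j\<in>I. \<Sum>x\<in>sign_cube I. x i * x j)"
    by (subst sum.swap, intro sum.cong refl, rule sum.swap)
  also have "\<dots> = (\<Sum>i\<in>I. \<Sum>j\<in>I. if i = j then 2 ^ card I else 0)"
    using assms by (intro sum.cong refl) (simp add: sum_sign_cube_mult)
  also have "\<dots> = card I * 2 ^ card I"
    using assms by simp
  finally show ?thesis .
qed

text \<open>This is Hoeffding's lemma for a fair sign: its auxiliary inequality, taken at probability
  \<open>1 / 2\<close> and \<open>h = 2\<bar>x\<bar>\<close>, bounds \<open>ln (cosh x)\<close> by \<open>h\<^sup>2 / 8\<close>.\<close>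

lemma cosh_le_exp_half_square: "cosh (x::real) \<le> exp (x\<^sup>2 / 2)"
proof -
  define h where "h = 2 * \<bar>x\<bar>"
  have "cosh x = exp (-h * (1/2)) * (1 + 1/2 * (exp h - 1))"
    unfolding h_def cosh_def by (cases "x \<ge> 0") (auto simp: field_simps simp flip: exp_add)
  also have "\<dots> = exp (-h * (1/2) + ln (1 + 1/2 * (exp h - 1)))"
    by (subst exp_add, subst exp_ln) (auto simp: h_def intro!: add_pos_nonneg)
  also have "\<dots> \<le> exp (h\<^sup>2 / 8)"
    using Hoeffdings_lemma_aux[of h "1/2"] by (simp add: h_def)
  also have "h\<^sup>2 / 8 = x\<^sup>2 / 2"
    by (simp add: h_def power_mult_distrib)
  finally show ?thesis .
qed

text \<open>A single term of the power series of \<open>cosh\<close>, all of whose terms are nonnegative.\<close>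

lemma even_power_le_fact_cosh: "(y::real) ^ (2 * k) \<le> fact (2 * k) * cosh y"
proof -
  let ?f = "\<lambda>n. if even n then y ^ n /\<^sub>R fact n else 0"
  have "sum ?f {2 * k} \<le> suminf ?f"
    by (intro sum_le_suminf sums_summable[OF cosh_converges])
       (auto simp: zero_le_even_power)
  then have "y ^ (2 * k) / fact (2 * k) \<le> cosh y"
    using sums_unique[OF cosh_converges[of y]] by (simp add: field_simps)
  then show ?thesis
    by (simp add: divide_le_eq mult.commute)
qed

text \<open>The exponential moment of a Rademacher sum factorises over the coordinates; passing to
  \<open>cosh\<close> loses nothing, since the sum is symmetric.\<close>

lemma sum_sign_cube_cosh_le:
  assumes "finite I"
  shows "(\<Sum>x\<in>sign_cube I. cosh (\<Sum>j\<in>I. b j * x j)) \<le> 2 ^ card I * exp ((\<Sum>j\<in>I. (b j)\<^sup>2) / 2)"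
proof -
  have exp_sum_eq: "(\<Sum>x\<in>sign_cube I. exp (\<Sum>j\<in>I. c j * x j)) = (\<Prod>j\<in>I. 2 * cosh (c j))" for c
  proof -
    have "(\<Sum>x\<in>sign_cube I. exp (\<Sum>j\<in>I. c j * x j)) = (\<Sum>x\<in>sign_cube I. \<Prod>j\<in>I. exp (c j * x j))"
      using assms by (simp add: exp_sum)
    also have "\<dots> = (\<Prod>j\<in>I. exp (c j * (-1)) + exp (c j * 1))"
      using assms by (rule sum_sign_cube_prod[where f = "\<lambda>j v. exp (c j * v)"])
    also have "\<dots> = (\<Prod>j\<in>I. 2 * cosh (c j))"
      by (intro prod.cong refl) (simp add: cosh_def field_simps)
    finally show ?thesis .
  qed
  have "(\<Sum>x\<in>sign_cube I. cosh (\<Sum>j\<in>I. b j * x j))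
      = ((\<Sum>x\<in>sign_cube I. exp (\<Sum>j\<in>I. b j * x j)) + (\<Sum>x\<in>sign_cube I. exp (\<Sum>j\<in>I. - b j * x j))) / 2"
    by (simp add: cosh_def sum.distrib sum_negf sum_divide_distrib add_divide_distrib)
  also have "\<dots> = (\<Prod>j\<in>I. 2 * cosh (b j))"
    using exp_sum_eq[of b] exp_sum_eq[of "\<lambda>j. - b j"] by simp
  also have "\<dots> \<le> (\<Prod>j\<in>I. 2 * exp ((b j)\<^sup>2 / 2))"
    by (intro prod_mono) (auto simp: cosh_le_exp_half_square)
  also have "\<dots> = 2 ^ card I * exp ((\<Sum>j\<in>I. (b j)\<^sup>2) / 2)"
    using assms by (simp add: prod.distrib exp_sum sum_divide_distrib)
  finally show ?thesis .
qed

text \<open>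
  Chernoff's method for moments: \<open>X ^ (2k)\<close> is bounded by \<open>(2k)! cosh (c X) / c ^ (2k)\<close>, whose mean
  is at most \<open>(2k)! exp (c\<^sup>2 s / 2) / c ^ (2k)\<close>, and the choice \<open>c\<^sup>2 s = 2k\<close> minimises this. The
  estimate \<open>(2k)! / k! \<le> (2k) ^ k\<close> then leaves a bound which grows like \<open>k!\<close>, exactly what the
  exponential series of \<open>X\<^sup>2\<close> can absorb. The variance enters only through an upper bound \<open>s\<close>, so
  that the real and the imaginary part of a complex sum can share the same \<open>s\<close>.
\<close>

lemma sum_sign_cube_even_moment_le:
  assumes "finite I" "s > 0" "(\<Sum>j\<in>I. (b j)\<^sup>2) \<le> s"
  shows "(\<Sum>x\<in>sign_cube I. (\<Sum>j\<in>I. b j * x j) ^ (2 * k)) \<le> 2 ^ card I * fact k * (exp 1 * s) ^ k"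
proof (cases "k = 0")
  case True
  then show ?thesis using assms(1) by (simp add: card_sign_cube)
next
  case False
  define c where "c = sqrt (2 * k / s)"
  have c: "c\<^sup>2 * s = 2 * k" "c > 0"
    using assms(2) False by (auto simp: c_def)
  let ?X = "\<lambda>x. \<Sum>j\<in>I. b j * x j"
  have "(2 * k / s) ^ k * (\<Sum>x\<in>sign_cube I. ?X x ^ (2 * k)) = (\<Sum>x\<in>sign_cube I. (c * ?X x) ^ (2 * k))"
  proof -
    have "2 * real k / s = c\<^sup>2"
      using c(1) assms(2) by (simp add: field_simps)
    then show ?thesis
      by (simp add: power_mult_distrib flip: power_mult sum_distrib_left)
  qed
  also have "\<dots> \<le> (\<Sum>x\<in>sign_cube I. fact (2 * k) * cosh (c * ?X x))"
    by (intro sum_mono even_power_le_fact_cosh)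
  also have "\<dots> = fact (2 * k) * (\<Sum>x\<in>sign_cube I. cosh (\<Sum>j\<in>I. (c * b j) * x j))"
    by (simp add: sum_distrib_left mult.assoc)
  also have "\<dots> \<le> fact (2 * k) * (2 ^ card I * exp ((\<Sum>j\<in>I. (c * b j)\<^sup>2) / 2))"
    using assms(1) by (intro mult_left_mono sum_sign_cube_cosh_le) auto
  also have "(\<Sum>j\<in>I. (c * b j)\<^sup>2) / 2 = c\<^sup>2 * (\<Sum>j\<in>I. (b j)\<^sup>2) / 2"
    by (simp add: power_mult_distrib sum_distrib_left)
  also have "fact (2 * k) * (2 ^ card I * exp (c\<^sup>2 * (\<Sum>j\<in>I. (b j)\<^sup>2) / 2))
      \<le> fact (2 * k) * (2 ^ card I * exp (c\<^sup>2 * s / 2))"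
    using assms(3) by (simp add: mult_left_mono)
  also have "exp (c\<^sup>2 * s / 2) = exp 1 ^ k"
    using c(1) by (simp flip: exp_of_nat_mult)
  also have "fact (2 * k) * (2 ^ card I * exp 1 ^ k) \<le> ((2 * real k) ^ k * fact k) * (2 ^ card I * exp 1 ^ k)"
  proof (intro mult_right_mono)
    have "fact (2 * k) = (fact (2 * k) div fact k) * (fact k :: nat)"
      by (simp add: fact_dvd)
    also have "\<dots> \<le> (2 * k) ^ k * fact k"
      using fact_div_fact_le_pow[of k "2 * k"] by (intro mult_right_mono) (auto simp: mult_2)
    finally have "real (fact (2 * k)) \<le> real ((2 * k) ^ k * fact k)"
      by (rule of_nat_mono)
    then show "fact (2 * k) \<le> (2 * real k) ^ k * fact k"
      by simp
  qed auto
  finally have "(2 * k / s) ^ k * (\<Sum>x\<in>sign_cube I. ?X x ^ (2 * k))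
      \<le> (2 * k / s) ^ k * (2 ^ card I * fact k * (exp 1 * s) ^ k)"
    using assms(2) by (simp add: power_divide power_mult_distrib field_simps)
  then show ?thesis
    using assms(2) False by (subst (asm) mult_le_cancel_left_pos) auto
qed

text \<open>Expanding the exponential and inserting the moment bounds, the scale \<open>2 e s\<close> turns the series
  into the geometric series of ratio \<open>1 / 2\<close>.\<close>

lemma sum_sign_cube_exp_square_le:
  assumes "finite I" "s > 0" "(\<Sum>j\<in>I. (b j)\<^sup>2) \<le> s"
  shows "(\<Sum>x\<in>sign_cube I. exp ((\<Sum>j\<in>I. b j * x j)\<^sup>2 / (2 * exp 1 * s))) \<le> 2 * 2 ^ card I"
proof -
  let ?X = "\<lambda>x. \<Sum>j\<in>I. b j * x j"
  have series: "(\<lambda>k. \<Sum>x\<in>sign_cube I. ((?X x)\<^sup>2 / (2 * exp 1 * s)) ^ k /\<^sub>R fact k)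
      sums (\<Sum>x\<in>sign_cube I. exp ((?X x)\<^sup>2 / (2 * exp 1 * s)))"
    by (intro sums_sum exp_converges)
  have geometric: "(\<lambda>k. 2 ^ card I * (1 / 2) ^ k) sums (2 ^ card I * 2 :: real)"
    using sums_mult[OF geometric_sums[of "1 / 2 :: real"], of "2 ^ card I"] by simp
  have termwise: "(\<Sum>x\<in>sign_cube I. ((?X x)\<^sup>2 / (2 * exp 1 * s)) ^ k /\<^sub>R fact k) \<le> 2 ^ card I * (1 / 2) ^ k" for k
  proof -
    have "(\<Sum>x\<in>sign_cube I. ((?X x)\<^sup>2 / (2 * exp 1 * s)) ^ k /\<^sub>R fact k)
        = (\<Sum>x\<in>sign_cube I. ?X x ^ (2 * k)) / (fact k * (2 * exp 1 * s) ^ k)"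
      by (simp add: sum_divide_distrib power_divide field_simps flip: power_mult)
    also have "\<dots> \<le> (2 ^ card I * fact k * (exp 1 * s) ^ k) / (fact k * (2 * exp 1 * s) ^ k)"
      using assms by (intro divide_right_mono sum_sign_cube_even_moment_le) auto
    also have "\<dots> = 2 ^ card I * (1 / 2) ^ k"
      using assms(2) by (simp add: power_mult_distrib power_divide field_simps)
    finally show ?thesis .
  qed
  have "(\<Sum>x\<in>sign_cube I. exp ((?X x)\<^sup>2 / (2 * exp 1 * s))) \<le> 2 ^ card I * 2"
    using termwise series geometric by (rule sums_le)
  then show ?thesis by simp
qed

text \<open>The squared modulus is the sum of the squares of two real Rademacher sums; the
  arithmetic-geometric mean inequality separates their exponentials at the price of a factor
  \<open>2\<close> in the scale.\<close>

lemma sum_sign_cube_exp_cmod_square_le: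
  fixes a :: "'i \<Rightarrow> complex"
  assumes "finite I" "F \<subseteq> I" "s > 0" "(\<Sum>j\<in>F. (cmod (a j))\<^sup>2) \<le> s"
  shows "(\<Sum>x\<in>sign_cube I. exp ((cmod (\<Sum>j\<in>F. a j * complex_of_real (x j)))\<^sup>2 / (4 * exp 1 * s))) \<le> 2 * 2 ^ card I"
proof -
  \<comment> \<open>extension by zero, so that the coefficients live on all of \<open>I\<close>\<close>
  define u where "u = (\<lambda>j. if j \<in> F then Re (a j) else 0)"
  define v where "v = (\<lambda>j. if j \<in> F then Im (a j) else 0)"
  define d where "d = 2 * exp 1 * s"
  have restrict: "(\<Sum>j\<in>I. if j \<in> F then g j else 0) = sum g F" for g :: "'i \<Rightarrow> real"
    using assms(1,2) by (simp add: sum.If_cases Int_absorb1)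
  have "(\<Sum>j\<in>I. (u j)\<^sup>2) = (\<Sum>j\<in>F. (Re (a j))\<^sup>2)" "(\<Sum>j\<in>I. (v j)\<^sup>2) = (\<Sum>j\<in>F. (Im (a j))\<^sup>2)"
    by (simp_all add: u_def v_def if_distrib[of "\<lambda>z. z\<^sup>2"] flip: restrict cong: if_cong)
  moreover have "(\<Sum>j\<in>F. (Re (a j))\<^sup>2) \<le> (\<Sum>j\<in>F. (cmod (a j))\<^sup>2)" "(\<Sum>j\<in>F. (Im (a j))\<^sup>2) \<le> (\<Sum>j\<in>F. (cmod (a j))\<^sup>2)"
    by (intro sum_mono; simp add: cmod_power2)+
  ultimately have uv: "(\<Sum>j\<in>I. (u j)\<^sup>2) \<le> s" "(\<Sum>j\<in>I. (v j)\<^sup>2) \<le> s"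
    using assms(4) by auto
  have "exp ((cmod (\<Sum>j\<in>F. a j * complex_of_real (x j)))\<^sup>2 / (4 * exp 1 * s))
     \<le> (exp ((\<Sum>j\<in>I. u j * x j)\<^sup>2 / d) + exp ((\<Sum>j\<in>I. v j * x j)\<^sup>2 / d)) / 2" for x
  proof -
    define A where "A = (\<Sum>j\<in>I. u j * x j)\<^sup>2 / d"
    define B where "B = (\<Sum>j\<in>I. v j * x j)\<^sup>2 / d"
    have "(\<Sum>j\<in>I. u j * x j) = Re (\<Sum>j\<in>F. a j * complex_of_real (x j))"
         "(\<Sum>j\<in>I. v j * x j) = Im (\<Sum>j\<in>F. a j * complex_of_real (x j))"
      by (simp_all add: u_def v_def if_distrib[of "\<lambda>z. z * _"] flip: restrict cong: if_cong)
    then have "(cmod (\<Sum>j\<in>F. a j * complex_of_real (x j)))\<^sup>2 / (4 * exp 1 * s) = A / 2 + B / 2"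
      using assms(3) by (simp add: A_def B_def d_def cmod_power2 field_simps)
    moreover have "exp (A / 2 + B / 2) \<le> (exp A + exp B) / 2"
      using sum_squares_bound[of "exp (A / 2)" "exp (B / 2)"]
      by (simp add: exp_add flip: exp_double)
    ultimately show ?thesis by (simp add: A_def B_def)
  qed
  then have "(\<Sum>x\<in>sign_cube I. exp ((cmod (\<Sum>j\<in>F. a j * complex_of_real (x j)))\<^sup>2 / (4 * exp 1 * s)))
     \<le> (\<Sum>x\<in>sign_cube I. (exp ((\<Sum>j\<in>I. u j * x j)\<^sup>2 / d) + exp ((\<Sum>j\<in>I. v j * x j)\<^sup>2 / d)) / 2)"
    by (intro sum_mono)
  also have "\<dots> = ((\<Sum>x\<in>sign_cube I. exp ((\<Sum>j\<in>I. u j * x j)\<^sup>2 / d))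
                + (\<Sum>x\<in>sign_cube I. exp ((\<Sum>j\<in>I. v j * x j)\<^sup>2 / d))) / 2"
    by (simp add: sum.distrib flip: sum_divide_distrib)
  also have "\<dots> \<le> (2 * 2 ^ card I + 2 * 2 ^ card I) / 2"
    unfolding d_def using assms(1,3) uv
    by (intro divide_right_mono add_mono sum_sign_cube_exp_square_le) auto
  finally show ?thesis by simp
qed

section \<open>The reweighted Rademacher system\<close>

text \<open>The density \<open>p\<close>. It has to have mean \<open>1\<close>, to stay away from \<open>0\<close> and to dominate a multiple
  of \<open>S\<^sup>2 / N\<close>; averaging the constant \<open>1\<close> with \<open>S\<^sup>2 / N\<close> does all three.\<close>

definition tilt :: "'i set \<Rightarrow> ('i \<Rightarrow> real) \<Rightarrow> real" where
  "tilt I x = (1 + (\<Sum>j\<in>I. x j)\<^sup>2 / card I) / 2"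

definition tilted_measure :: "'i set \<Rightarrow> ('i \<Rightarrow> real) measure" where
  "tilted_measure I = point_measure (sign_cube I) (\<lambda>x. ennreal (tilt I x / 2 ^ card I))"

definition tilted_sign :: "'i set \<Rightarrow> 'i \<Rightarrow> ('i \<Rightarrow> real) \<Rightarrow> real" where
  "tilted_sign I j x = x j / sqrt (tilt I x)"

lemma tilt_ge_half: "tilt I x \<ge> 1 / 2"
  by (simp add: tilt_def)

lemma tilt_pos: "tilt I x > 0"
  using tilt_ge_half[of I x] by linarith

lemma space_tilted_measure: "space (tilted_measure I) = sign_cube I"
  by (simp add: tilted_measure_def space_point_measure)

lemma measurable_tilted_measure: "space N = UNIV \<Longrightarrow> f \<in> measurable (tilted_measure I) N"
  by (simp add: tilted_measure_def)

lemma prob_space_tilted_measure: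
  assumes "finite I" "I \<noteq> {}"
  shows "prob_space (tilted_measure I)"
proof
  have "(\<Sum>x\<in>sign_cube I. tilt I x / 2 ^ card I)
      = (real (card (sign_cube I)) + (\<Sum>x\<in>sign_cube I. (\<Sum>j\<in>I. x j)\<^sup>2) / card I) / 2 / 2 ^ card I"
    by (simp add: tilt_def sum.distrib flip: sum_divide_distrib)
  also have "\<dots> = 1"
    using assms by (simp add: card_sign_cube sum_sign_cube_sum_square field_simps card_eq_0_iff)
  finally have total: "(\<Sum>x\<in>sign_cube I. tilt I x / 2 ^ card I) = 1" .
  have "emeasure (tilted_measure I) (sign_cube I) = (\<Sum>x\<in>sign_cube I. ennreal (tilt I x / 2 ^ card I))"
    unfolding tilted_measure_def
    using assms(1) by (simp add: emeasure_point_measure_finite finite_sign_cube)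
  also have "\<dots> = ennreal (\<Sum>x\<in>sign_cube I. tilt I x / 2 ^ card I)"
    by (intro sum_ennreal) (simp add: tilt_pos less_imp_le)
  finally show "emeasure (tilted_measure I) (space (tilted_measure I)) = 1"
    by (simp add: space_tilted_measure total)
qed

text \<open>The two factors \<open>1 / \<surd>p\<close> cancel the density, leaving the orthogonality of the signs.\<close>

lemma orthonormal_tilted_sign:
  assumes "finite I"
  shows "orthonormal_system (tilted_measure I) I (tilted_sign I)"
proof -
  have "integrable (tilted_measure I) f" for f :: "_ \<Rightarrow> real"
    unfolding tilted_measure_def using assms by (simp add: finite_sign_cube integrable_point_measure_finite)
  moreover have "(\<integral>x. tilted_sign I i x * tilted_sign I j x \<partial>tilted_measure I) = (if i = j then 1 else 0)"
    if "i \<in> I" "j \<in> I" for i j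
  proof -
    have "(\<integral>x. tilted_sign I i x * tilted_sign I j x \<partial>tilted_measure I)
        = (\<Sum>x\<in>sign_cube I. tilt I x / 2 ^ card I * (tilted_sign I i x * tilted_sign I j x))"
      unfolding tilted_measure_def using assms
      by (subst lebesgue_integral_point_measure_finite) (auto simp: finite_sign_cube tilt_pos less_imp_le)
    also have "\<dots> = (\<Sum>x\<in>sign_cube I. x i * x j / 2 ^ card I)"
      by (intro sum.cong refl) (simp add: tilted_sign_def tilt_pos less_imp_le less_imp_neq[symmetric])
    also have "\<dots> = (\<Sum>x\<in>sign_cube I. x i * x j) / 2 ^ card I"
      by (simp add: sum_divide_distrib)
    also have "\<dots> = (if i = j then 1 else 0)"
      using assms that by (simp add: sum_sign_cube_mult)
    finally show ?thesis .
  qed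
  ultimately show ?thesis
    by (simp add: orthonormal_system_def measurable_tilted_measure)
qed

lemma Linf_norm_tilted_measure_le:
  assumes "\<And>x. x \<in> sign_cube I \<Longrightarrow> norm (f x) \<le> c"
  shows "Linf_norm (tilted_measure I) f \<le> ennreal c"
  unfolding Linf_norm_def using assms
  by (intro esssup_I measurable_tilted_measure AE_I2 ennreal_leI) (auto simp: space_tilted_measure)

lemma abs_tilted_sign_le:
  assumes "x \<in> sign_cube I" "j \<in> I"
  shows "\<bar>tilted_sign I j x\<bar> \<le> sqrt 2"
proof -
  have "\<bar>tilted_sign I j x\<bar> = 1 / sqrt (tilt I x)"
    using sign_cube_abs[OF assms] tilt_pos[of I x] by (simp add: tilted_sign_def abs_divide)
  also have "\<dots> \<le> 1 / sqrt (1 / 2)"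
    by (intro divide_left_mono real_sqrt_le_mono tilt_ge_half mult_pos_pos) (auto simp: tilt_pos)
  also have "\<dots> = sqrt 2"
    by (simp add: real_sqrt_divide)
  finally show ?thesis .
qed

text \<open>This is what the reweighting is for: untilted, the sum of the signs attains
  \<open>card I\<close>.\<close>

lemma abs_sum_tilted_sign_le:
  assumes "finite I" "I \<noteq> {}"
  shows "\<bar>\<Sum>j\<in>I. tilted_sign I j x\<bar> \<le> sqrt (2 * card I)"
proof (rule real_le_rsqrt)
  let ?S = "\<Sum>j\<in>I. x j"
  have N: "real (card I) > 0"
    using assms by (simp add: card_gt_0_iff)
  have "(\<Sum>j\<in>I. tilted_sign I j x) = ?S / sqrt (tilt I x)"
    by (simp add: tilted_sign_def sum_divide_distrib)
  then have "\<bar>\<Sum>j\<in>I. tilted_sign I j x\<bar>\<^sup>2 = ?S\<^sup>2 / tilt I x"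
    using tilt_pos[of I x] by (simp add: power_divide)
  also have "?S\<^sup>2 \<le> 2 * card I * tilt I x"
    using N by (simp add: tilt_def field_simps)
  then have "?S\<^sup>2 / tilt I x \<le> 2 * card I"
    using tilt_pos[of I x] by (simp add: divide_le_eq)
  finally show "\<bar>\<Sum>j\<in>I. tilted_sign I j x\<bar>\<^sup>2 \<le> 2 * card I" .
qed

text \<open>The point \<open>y / c\<close> is the convex combination of \<open>y\<close> and \<open>0\<close> with weight \<open>1 / c\<close>.\<close>

lemma scaled_exp_minus_one_le:
  assumes "c \<ge> 1"
  shows "c * (exp (y / c) - 1) \<le> exp (y::real) - 1"
proof -
  have "exp (1 / c * y) \<le> (1 - 1 / c) * exp 0 + 1 / c * exp y"
    using convex_onD[OF convex_on_exp[of 1], of "1 / c" 0 y] assms by simp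
  then show ?thesis
    using assms by (simp add: field_simps)
qed

lemma psi2_norm_le:
  assumes "t > 0" "(\<integral>\<^sup>+ x. ennreal (exp ((norm (f x))\<^sup>2 / t\<^sup>2) - 1) \<partial>M) \<le> 1"
  shows "psi2_norm M f \<le> ennreal t"
  unfolding psi2_norm_def using assms by (intro Inf_lower) auto

text \<open>
  By \<open>scaled_exp_minus_one_le\<close> with \<open>c = 2p \<ge> 1\<close> the density is absorbed pointwise, so the integral
  is at most half of the mean of \<open>exp (\<bar>Z\<bar>\<^sup>2 / (4 e s)) - 1\<close>, where \<open>Z\<close> is the untilted sum; that
  mean is at most \<open>1\<close>. The constant \<open>8 e\<close> is \<open>4 e\<close> times the factor \<open>2\<close> in \<open>c\<close>. Taking a bound
  \<open>s > 0\<close> for the sum of squares, instead of the sum itself, covers vanishing coefficients by a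
  limit.
\<close>

lemma psi2_norm_tilted_sign_le:
  fixes a :: "'i \<Rightarrow> complex"
  assumes "finite I" "F \<subseteq> I" "s > 0" "(\<Sum>j\<in>F. (cmod (a j))\<^sup>2) \<le> s"
  shows "psi2_norm (tilted_measure I) (\<lambda>x. \<Sum>j\<in>F. a j * complex_of_real (tilted_sign I j x))
    \<le> ennreal (sqrt (8 * exp 1) * sqrt s)"
proof (rule psi2_norm_le)
  let ?Z = "\<lambda>x. \<Sum>j\<in>F. a j * complex_of_real (x j)"
  let ?f = "\<lambda>x. \<Sum>j\<in>F. a j * complex_of_real (tilted_sign I j x)"
  let ?t = "sqrt (8 * exp 1) * sqrt s"
  have t2: "?t\<^sup>2 = 8 * exp 1 * s"
    using assms(3) by (simp add: power_mult_distrib)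
  have bound: "tilt I x * (exp ((norm (?f x))\<^sup>2 / ?t\<^sup>2) - 1)
      \<le> (exp ((cmod (?Z x))\<^sup>2 / (4 * exp 1 * s)) - 1) / 2" for x
  proof -
    have "?f x = ?Z x / complex_of_real (sqrt (tilt I x))"
      by (simp add: tilted_sign_def sum_divide_distrib)
    then have "(norm (?f x))\<^sup>2 = (cmod (?Z x))\<^sup>2 / tilt I x"
      using tilt_pos[of I x] by (simp add: norm_divide power_divide)
    then have "(norm (?f x))\<^sup>2 / ?t\<^sup>2 = (cmod (?Z x))\<^sup>2 / (4 * exp 1 * s) / (2 * tilt I x)"
      unfolding t2 by simp
    then show ?thesis
      using scaled_exp_minus_one_le[of "2 * tilt I x" "(cmod (?Z x))\<^sup>2 / (4 * exp 1 * s)"]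
        tilt_ge_half[of I x] by simp
  qed
  have "(\<integral>\<^sup>+ x. ennreal (exp ((norm (?f x))\<^sup>2 / ?t\<^sup>2) - 1) \<partial>tilted_measure I)
      = (\<Sum>x\<in>sign_cube I. ennreal (tilt I x / 2 ^ card I) * ennreal (exp ((norm (?f x))\<^sup>2 / ?t\<^sup>2) - 1))"
    unfolding tilted_measure_def using assms(1)
    by (simp add: nn_integral_point_measure_finite finite_sign_cube)
  also have "\<dots> = ennreal (\<Sum>x\<in>sign_cube I. tilt I x * (exp ((norm (?f x))\<^sup>2 / ?t\<^sup>2) - 1) / 2 ^ card I)"
    by (subst sum_ennreal[symmetric])
       (auto intro!: sum.cong simp: tilt_pos less_imp_le simp flip: ennreal_mult)
  also have "\<dots> \<le> ennreal 1"
  proof (rule ennreal_leI)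
    have "(\<Sum>x\<in>sign_cube I. tilt I x * (exp ((norm (?f x))\<^sup>2 / ?t\<^sup>2) - 1) / 2 ^ card I)
        \<le> (\<Sum>x\<in>sign_cube I. (exp ((cmod (?Z x))\<^sup>2 / (4 * exp 1 * s)) - 1) / 2 / 2 ^ card I)"
      by (intro sum_mono divide_right_mono bound) auto
    also have "\<dots> = ((\<Sum>x\<in>sign_cube I. exp ((cmod (?Z x))\<^sup>2 / (4 * exp 1 * s))) - 2 ^ card I) / 2 / 2 ^ card I"
      using assms(1) by (simp add: sum_subtractf card_sign_cube flip: sum_divide_distrib)
    also have "\<dots> \<le> (2 * 2 ^ card I - 2 ^ card I) / 2 / 2 ^ card I"
      using assms by (intro divide_right_mono diff_right_mono sum_sign_cube_exp_cmod_square_le) auto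
    also have "\<dots> \<le> 1" by simp
    finally show "(\<Sum>x\<in>sign_cube I. tilt I x * (exp ((norm (?f x))\<^sup>2 / ?t\<^sup>2) - 1) / 2 ^ card I) \<le> 1" .
  qed
  finally show "(\<integral>\<^sup>+ x. ennreal (exp ((norm (?f x))\<^sup>2 / ?t\<^sup>2) - 1) \<partial>tilted_measure I) \<le> 1"
    by simp
qed (use assms in simp)

lemma psi2_condition_tilted_sign:
  assumes "finite I"
  shows "psi2_condition (tilted_measure I) I (\<lambda>j x. complex_of_real (tilted_sign I j x)) (sqrt (8 * exp 1))"
  unfolding psi2_condition_def
proof (intro allI impI)
  fix F and a :: "'a \<Rightarrow> complex"
  assume F: "finite F \<and> F \<subseteq> I"
  let ?s = "\<Sum>j\<in>F. (cmod (a j))\<^sup>2"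
  let ?norm = "psi2_norm (tilted_measure I) (\<lambda>x. \<Sum>j\<in>F. a j * complex_of_real (tilted_sign I j x))"
  show "?norm \<le> ennreal (sqrt (8 * exp 1) * sqrt ?s)"
  proof (cases "?s > 0")
    case True
    then show ?thesis
      using psi2_norm_tilted_sign_le[OF assms, of F ?s a] F by simp
  next
    case False
    then have s0: "?s = 0"
      by (meson not_less order_antisym sum_nonneg zero_le_power2)
    \<comment> \<open>choose \<open>s\<close> such that the bound \<open>sqrt (8 * exp 1) * sqrt s\<close> equals \<open>e\<close>\<close>
    have "?norm \<le> 0 + ennreal e" if "e > 0" for e
      using psi2_norm_tilted_sign_le[OF assms, of F "(e / sqrt (8 * exp 1))\<^sup>2" a] F that s0 by simp
    then have "?norm \<le> 0"
      by (rule ennreal_le_epsilon)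
    then show ?thesis
      unfolding s0 by simp
  qed
qed

theorem theorem2:
  shows "\<exists>(C::real) (C'::real) (n0::nat). C > 0 \<and> C' > 0 \<and>
    (\<forall>n\<ge>n0. \<exists>(M :: sample_point measure) (\<phi> :: nat \<Rightarrow> sample_point \<Rightarrow> real).
       prob_space M \<and>
       orthonormal_system M {0..n} \<phi> \<and>
       (\<forall>j\<in>{0..n}. Linf_norm M (\<phi> j) \<le> 7) \<and>
       psi2_condition M {0..n} (\<lambda>j x. complex_of_real (\<phi> j x)) C \<and>
       (\<exists>a :: nat \<Rightarrow> real. (\<exists>j\<in>{0..n}. a j \<noteq> 0) \<and>
          Linf_norm M (\<lambda>x. \<Sum>j=0..n. a j * \<phi> j x)
            \<le> ennreal (C' / sqrt (ln (real n)) * (\<Sum>j=0..n. \<bar>a j\<bar>))))"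
  \<comment> \<open>\<open>n0 = 2\<close> keeps \<open>ln n\<close> positive: at \<open>n = 1\<close> the quotient by \<open>sqrt (ln 1)\<close> is \<open>0\<close> by
    convention, and the bound fails\<close>
proof (rule exI[of _ "sqrt (8 * exp 1)"], rule exI[of _ "sqrt 2"], rule exI[of _ "2::nat"], intro conjI allI impI)
  fix n :: nat
  assume n: "n \<ge> 2"
  let ?I = "{0..n}"
  have sup_single: "Linf_norm (tilted_measure ?I) (tilted_sign ?I j) \<le> 7" if "j \<in> ?I" for j
  proof -
    have "sqrt 2 \<le> (7::real)"
      by (rule real_le_lsqrt) auto
    then have "Linf_norm (tilted_measure ?I) (tilted_sign ?I j) \<le> ennreal 7"
      using that by (intro Linf_norm_tilted_measure_le) (auto intro: order_trans[OF abs_tilted_sign_le])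
    then show ?thesis by simp
  qed
  have sup_sum: "Linf_norm (tilted_measure ?I) (\<lambda>x. \<Sum>j=0..n. 1 * tilted_sign ?I j x)
      \<le> ennreal (sqrt 2 / sqrt (ln (real n)) * (\<Sum>j=0..n. \<bar>1\<bar>))"
  proof (rule Linf_norm_tilted_measure_le)
    fix x :: sample_point
    have ln: "0 < ln (real n)" "ln (real n) \<le> real (n + 1)"
      using n ln_le_minus_one[of "real n"] by auto
    have "norm (\<Sum>j=0..n. 1 * tilted_sign ?I j x) \<le> sqrt (2 * real (n + 1))"
      using abs_sum_tilted_sign_le[of ?I x] by simp
    also have "\<dots> = sqrt 2 / sqrt (real (n + 1)) * real (n + 1)"
    proof -
      have "sqrt (2 * m) = sqrt 2 / sqrt m * m" if "m > 0" for m :: real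
        using that by (simp add: real_sqrt_mult real_div_sqrt flip: times_divide_eq_right)
      from this[of "real (n + 1)"] show ?thesis by simp
    qed
    also have "\<dots> \<le> sqrt 2 / sqrt (ln (real n)) * real (n + 1)"
      using ln by (intro mult_right_mono divide_left_mono real_sqrt_le_mono mult_pos_pos) auto
    finally show "norm (\<Sum>j=0..n. 1 * tilted_sign ?I j x)
        \<le> sqrt 2 / sqrt (ln (real n)) * (\<Sum>j=0..n. \<bar>1\<bar>)"
      by simp
  qed
  show "\<exists>(M :: sample_point measure) (\<phi> :: nat \<Rightarrow> sample_point \<Rightarrow> real).
       prob_space M \<and>
       orthonormal_system M {0..n} \<phi> \<and>
       (\<forall>j\<in>{0..n}. Linf_norm M (\<phi> j) \<le> 7) \<and>
       psi2_condition M {0..n} (\<lambda>j x. complex_of_real (\<phi> j x)) (sqrt (8 * exp 1)) \<and>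
       (\<exists>a :: nat \<Rightarrow> real. (\<exists>j\<in>{0..n}. a j \<noteq> 0) \<and>
          Linf_norm M (\<lambda>x. \<Sum>j=0..n. a j * \<phi> j x)
            \<le> ennreal (sqrt 2 / sqrt (ln (real n)) * (\<Sum>j=0..n. \<bar>a j\<bar>)))"
  proof (intro exI[of _ "tilted_measure ?I"] exI[of _ "tilted_sign ?I"] exI[of _ "\<lambda>_. 1"] conjI ballI)
    show "prob_space (tilted_measure ?I)"
      by (rule prob_space_tilted_measure) auto
    show "orthonormal_system (tilted_measure ?I) ?I (tilted_sign ?I)"
      by (rule orthonormal_tilted_sign) simp
    show "psi2_condition (tilted_measure ?I) ?I (\<lambda>j x. complex_of_real (tilted_sign ?I j x)) (sqrt (8 * exp 1))"
      by (rule psi2_condition_tilted_sign) simp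
    show "\<exists>j\<in>?I. (1::real) \<noteq> 0"
      by auto
  qed (fact sup_single sup_sum)+
qed auto

end
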